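(* Let $G=(V,E)$ be a finite directed graph in which every edge $e\in E$ is assigned a real length $\mu_e\ge 0$, and let $a,b\in V$ be distinct vertices. For real parameters $r,s>0$ let $\mu^{(r,s)}(a,b)\in[0,+\infty]$ be the $(r,s)$-resistance from $a$ to $b$, and let $\mu^{B}(a,b)\in[0,+\infty]$ be the bridge distance from $a$ to $b$. Then the bridge distance is the limit case $r=s\to 0$ of the $(r,s)$-resistance: $$\lim_{r\to 0^+}\mu^{(r,r)}(a,b)=\mu^{B}(a,b).$$
   Context: Directed graphs have no loops; parallel edges (directed similarly or oppositely) are allowed. An $(a,b)$-path is a directed path (without repeated vertices) from $a$ to $b$. An edge $e\in E$ is an $(a,b)$-bridge if it belongs to every $(a,b)$-path. Bridge distance: $\mu^{B}(a,b)=+\infty$ if $G$ has no $(a,b)$-path; otherwise $\mu^{B}(a,b)=\sum_e\mu_e$, the sum being over all $(a,b)$-bridges $e$ (so it is $0$ if $(a,b)$-paths exist but there are no $(a,b)$-bridges). $(r,s)$-resistance: a unit flow (current) from $a$ to $b$ is a vector $y^*=(y^*_e)_{e\in E}$ with $y^*_e\ge 0$ such that at every vertex $v\ne a,b$ the total flow on edges entering $v$ equals the total flow on edges leaving $v$, while at $a$ the outflow minus the inflow equals $1$ (and hence at $b$ the inflow minus the outflow equals $1$). For $r,s>0$ the dissipation of $y^*$ is $$F^*(y^* )=\sum_{e\in E}\frac{\mu_e^{s/r}}{1+1/r}\,(y^*_e)^{1+1/r}.$$ By the minimal dissipation principle the current distributes so as to minimize $F^*$, and the resistance $\mu^{(r,s)}(a,b)$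 of the two-pole network is given by $$\mu^{(r,s)}(a,b)^{s/r}=(1+1/r)\,\inf_{y^*}F^*(y^* )=\inf_{y^*}\sum_{e\in E}\mu_e^{s/r}(y^*_e)^{1+1/r},$$ the infimum being over all unit flows from $a$ to $b$ (with $\inf\emptyset=+\infty$, so $\mu^{(r,s)}(a,b)=+\infty$ if there is no $(a,b)$-path). *)

theory Defs
  imports "HOL-Analysis.Analysis" "Graph_Theory.Arc_Walk"
begin

definition ab_bridges :: "('a, 'b) pre_digraph \<Rightarrow> 'a \<Rightarrow> 'a \<Rightarrow> 'b set" where
  "ab_bridges G a b = {e \<in> arcs G. \<forall>p. pre_digraph.apath G a p b \<longrightarrow> e \<in> set p}"

definition bridge_dist :: "('a, 'b) pre_digraph \<Rightarrow> ('b \<Rightarrow> real) \<Rightarrow> 'a \<Rightarrow> 'a \<Rightarrow> ennreal" where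
  "bridge_dist G \<mu> a b =
     (if \<exists>p. pre_digraph.apath G a p b then ennreal (\<Sum>e\<in>ab_bridges G a b. \<mu> e) else \<infinity>)"

text \<open>
  Vectors indexed by the arcs are represented by functions on the whole arc type whose
  values outside \<^term>\<open>arcs G\<close> are never used.  The balance condition at \<^term>\<open>b\<close> is
  not imposed: it follows from the others when \<^term>\<open>a \<noteq> b\<close>.
\<close>

definition unit_flows :: "('a, 'b) pre_digraph \<Rightarrow> 'a \<Rightarrow> 'a \<Rightarrow> ('b \<Rightarrow> real) set" where
  "unit_flows G a b = {y.
     (\<forall>e\<in>arcs G. 0 \<le> y e) \<and>
     (\<forall>v\<in>verts G - {a, b}. (\<Sum>e\<in>in_arcs G v. y e) = (\<Sum>e\<in>out_arcs G v. y e)) \<and>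
     (\<Sum>e\<in>out_arcs G a. y e) - (\<Sum>e\<in>in_arcs G a. y e) = 1}"

definition dissipation ::
    "('a, 'b) pre_digraph \<Rightarrow> ('b \<Rightarrow> real) \<Rightarrow> real \<Rightarrow> real \<Rightarrow> ('b \<Rightarrow> real) \<Rightarrow> real" where
  "dissipation G \<mu> r s y =
     (\<Sum>e\<in>arcs G. \<mu> e powr (s / r) / (1 + 1 / r) * y e powr (1 + 1 / r))"

text \<open>Real powers on \<open>[0, \<infinity>]\<close>, meant for exponents \<open>p > 0\<close>, where \<open>\<infinity>\<close> to the power \<open>p\<close> is \<open>\<infinity>\<close>.\<close>

definition ennreal_rpow :: "ennreal \<Rightarrow> real \<Rightarrow> ennreal" where
  "ennreal_rpow x p = (if x = \<infinity> then \<infinity> else ennreal (enn2real x powr p))"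

text \<open>
  The resistance \<open>R\<close> is specified by \<open>R\<close> to the power \<open>s / r\<close> being \<open>1 + 1 / r\<close> times the minimal
  dissipation; for \<open>r, s > 0\<close> this is solved by taking the power \<open>r / s\<close>.
\<close>

definition resistance ::
    "('a, 'b) pre_digraph \<Rightarrow> ('b \<Rightarrow> real) \<Rightarrow> real \<Rightarrow> real \<Rightarrow> 'a \<Rightarrow> 'a \<Rightarrow> ennreal" where
  "resistance G \<mu> r s a b =
     ennreal_rpow
       (ennreal (1 + 1 / r) * (INF y\<in>unit_flows G a b. ennreal (dissipation G \<mu> r s y))) (r / s)"

end

theory Submission
  imports Defs
begin

text \<open>
  For \<open>s = r\<close> the resistance is the infimum over unit flows \<open>y\<close> of
  \<open>\<Sum>e. \<mu> e * y e powr (1 + 1 / r)\<close>. Every unit flow sends at least one unit through each bridge,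
  which is the only arc leaving the set of vertices reachable without it; hence the bridge distance
  is a lower bound. Conversely, the average of the unit flows along all paths has value 1 on the
  bridges and value less than 1 on every other arc, so that as \<open>r\<close> tends to 0 only the bridges
  contribute to the limit of its dissipation.
\<close>

context fin_digraph
begin

section \<open>Unit flows across arc cuts\<close>

lemma sum_out_arcs_eq:
  fixes y :: "'b \<Rightarrow> real"
  assumes "S \<subseteq> verts G"
  shows "(\<Sum>v\<in>S. \<Sum>e\<in>out_arcs G v. y e) = (\<Sum>e | e \<in> arcs G \<and> tail G e \<in> S. y e)"
proof -
  have "(\<Sum>v\<in>S. \<Sum>e\<in>out_arcs G v. y e) = (\<Sum>e\<in>(\<Union>v\<in>S. out_arcs G v). y e)"
    using finite_subset[OF assms finite_verts] by (subst sum.UNION_disjoint) auto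
  also have "(\<Union>v\<in>S. out_arcs G v) = {e \<in> arcs G. tail G e \<in> S}"
    by auto
  finally show ?thesis .
qed

lemma sum_in_arcs_eq:
  fixes y :: "'b \<Rightarrow> real"
  assumes "S \<subseteq> verts G"
  shows "(\<Sum>v\<in>S. \<Sum>e\<in>in_arcs G v. y e) = (\<Sum>e | e \<in> arcs G \<and> head G e \<in> S. y e)"
proof -
  have "(\<Sum>v\<in>S. \<Sum>e\<in>in_arcs G v. y e) = (\<Sum>e\<in>(\<Union>v\<in>S. in_arcs G v). y e)"
    using finite_subset[OF assms finite_verts] by (subst sum.UNION_disjoint) auto
  also have "(\<Union>v\<in>S. in_arcs G v) = {e \<in> arcs G. head G e \<in> S}"
    by auto
  finally show ?thesis .
qed

text \<open>Take the set \<open>S\<close> of vertices that walks from \<open>a\<close> reach without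
  using \<open>D\<close>. It contains \<open>a\<close> but not \<open>b\<close>, so its net outflow
  is 1, while every arc leaving it lies in \<open>D\<close>. Stating this for a set \<open>D\<close>
  covers both a bridge, \<open>D = {e}\<close>, and the absence of paths,
  \<open>D = {}\<close>.\<close>

lemma unit_flow_across_arc_cut:
  assumes y: "y \<in> unit_flows G a b" and a: "a \<in> verts G" and "D \<subseteq> arcs G"
    and cut: "\<And>p. apath a p b \<Longrightarrow> set p \<inter> D \<noteq> {}"
  shows "1 \<le> (\<Sum>e\<in>D. y e)"
proof -
  define S where "S = {v. \<exists>p. awalk a p v \<and> set p \<inter> D = {}}"
  have SV: "S \<subseteq> verts G"
    by (auto simp: S_def)
  have aS: "a \<in> S"
    using a by (auto simp: S_def awalk_Nil_iff intro!: exI[of _ "[]"])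
  have bS: "b \<notin> S"
  proof
    assume "b \<in> S"
    then obtain p where p: "awalk a p b" "set p \<inter> D = {}"
      by (auto simp: S_def)
    \<comment> \<open>Removing cycles from a walk only drops arcs, so the resulting path still
      avoids \<open>D\<close>, against \<open>cut\<close>.\<close>
    then have "set (awalk_to_apath p) \<inter> D = {}"
      using awalk_to_apath_subset by blast
    with cut[OF apath_awalk_to_apath[OF p(1)]] show False ..
  qed
  have leave: "e \<in> D" if "e \<in> arcs G" "tail G e \<in> S" "head G e \<notin> S" for e
  proof (rule ccontr)
    assume "e \<notin> D"
    from that obtain p where p: "awalk a p (tail G e)" "set p \<inter> D = {}"
      by (auto simp: S_def)
    with \<open>e \<in> arcs G\<close> have "awalk a (p @ [e]) (head G e)"
      by (auto simp: awalk_simps)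
    moreover have "set (p @ [e]) \<inter> D = {}"
      using p \<open>e \<notin> D\<close> by auto
    ultimately have "head G e \<in> S"
      unfolding S_def by blast
    with that show False
      by simp
  qed
  have nonneg: "0 \<le> y e" if "e \<in> arcs G" for e
    using y that by (simp add: unit_flows_def)
  have finD: "finite D"
    using finite_subset[OF \<open>D \<subseteq> arcs G\<close> finite_arcs] .
  have finS: "finite S"
    using finite_subset[OF SV finite_verts] .
  have "(\<Sum>v\<in>S. (\<Sum>e\<in>out_arcs G v. y e) - (\<Sum>e\<in>in_arcs G v. y e)) =
        (\<Sum>v\<in>S. if v = a then 1 else 0)"
  proof (intro sum.cong refl)
    fix v assume "v \<in> S"
    with SV bS have "v \<in> verts G" "v \<noteq> b"
      by auto
    with y show "(\<Sum>e\<in>out_arcs G v. y e) - (\<Sum>e\<in>in_arcs G v. y e) = (if v = a then 1 else 0)"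
      by (simp add: unit_flows_def)
  qed
  also have "\<dots> = 1"
    using finS aS by simp
  finally have "1 + (\<Sum>e | e \<in> arcs G \<and> head G e \<in> S. y e) =
      (\<Sum>e | e \<in> arcs G \<and> tail G e \<in> S. y e)"
    using sum_out_arcs_eq[OF SV, of y] sum_in_arcs_eq[OF SV, of y] by (simp add: sum_subtractf)
  \<comment> \<open>An arc with tail in \<open>S\<close> either stays in \<open>S\<close> or leaves
    it, and then lies in \<open>D\<close>.\<close>
  also have "\<dots> \<le> (\<Sum>e\<in>{e \<in> arcs G. head G e \<in> S} \<union> D. y e)"
    using leave \<open>D \<subseteq> arcs G\<close> finD by (intro sum_mono2) (auto intro: nonneg)
  also have "\<dots> \<le> (\<Sum>e | e \<in> arcs G \<and> head G e \<in> S. y e) + (\<Sum>e\<in>D. y e)"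
  \<comment> \<open>\<open>D\<close> may also contain arcs with head in \<open>S\<close>; counting
    these twice only enlarges the bound, since the flow is nonnegative.\<close>
  proof -
    have "0 \<le> (\<Sum>e\<in>{e \<in> arcs G. head G e \<in> S} \<inter> D. y e)"
      by (auto intro: sum_nonneg nonneg)
    then show ?thesis
      using finD by (simp add: sum_Un)
  qed
  finally show ?thesis
    by simp
qed

lemma unit_flows_empty:
  assumes "a \<in> verts G" and "\<nexists>p. apath a p b"
  shows "unit_flows G a b = {}"
proof (rule equals0I)
  fix y assume "y \<in> unit_flows G a b"
  \<comment> \<open>Without paths the empty set is a cut, which gives 1 \<le> 0.\<close>
  from unit_flow_across_arc_cut[OF this, of "{}"] assms show False
    by simp
qed

lemma unit_flow_ge_1_on_bridge:
  assumes "y \<in> unit_flows G a b" and "a \<in> verts G" and "e \<in> ab_bridges G a b"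
  shows "1 \<le> y e"
proof -
  have "set p \<inter> {e} \<noteq> {}" if "apath a p b" for p
    using assms(3) that by (simp add: ab_bridges_def)
  moreover have "e \<in> arcs G"
    using assms(3) by (simp add: ab_bridges_def)
  ultimately show ?thesis
    using unit_flow_across_arc_cut[OF assms(1,2), of "{e}"] by simp
qed

section \<open>The average of the path flows\<close>

lemma divergence_count_list:
  assumes "cas u p w" and "set p \<subseteq> arcs G"
  shows "(\<Sum>e\<in>out_arcs G v. real (count_list p e)) - (\<Sum>e\<in>in_arcs G v. real (count_list p e)) =
    of_bool (v = u) - of_bool (v = w)"
  using assms
proof (induction p arbitrary: u)
  case Nil
  then show ?case
    by simp
next
  case (Cons x p)
  have "real (count_list (x # p) e) = (if x = e then 1 else 0) + real (count_list p e)" for e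
    by simp
  then show ?case
    \<comment> \<open>The first arc adds 1 at its tail \<open>u\<close> and subtracts 1 at its head,
      where the rest of the walk starts, so the contributions telescope.\<close>
    using Cons.IH[of "head G x"] Cons.prems finite_in_arcs finite_out_arcs
    by (auto simp: sum.distrib simp del: count_list.simps(2))
qed

text \<open>Arcs are counted with multiplicity so that \<open>divergence_count_list\<close>, whose
  induction needs no distinctness, applies path by path. As paths repeat no arc, the value is the
  fraction of paths through \<open>e\<close>, see \<open>path_average_eq_card\<close>.\<close>

definition path_average :: "'a \<Rightarrow> 'a \<Rightarrow> 'b \<Rightarrow> real" where
  "path_average a b e = (\<Sum>p | apath a p b. real (count_list p e)) / real (card {p. apath a p b})"

lemma divergence_path_average:
  assumes "apath a q b"
  shows "(\<Sum>e\<in>out_arcs G v. path_average a b e) - (\<Sum>e\<in>in_arcs G v. path_average a b e) =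
    of_bool (v = a) - of_bool (v = b)"
proof -
  let ?P = "{p. apath a p b}"
  have card: "card ?P \<noteq> 0"
    using assms apaths_finite by auto
  have "(\<Sum>e\<in>out_arcs G v. path_average a b e) - (\<Sum>e\<in>in_arcs G v. path_average a b e) =
      (\<Sum>p\<in>?P. (\<Sum>e\<in>out_arcs G v. real (count_list p e)) -
        (\<Sum>e\<in>in_arcs G v. real (count_list p e))) / real (card ?P)"
    unfolding path_average_def sum_divide_distrib[symmetric] diff_divide_distrib[symmetric]
      sum_subtractf
    by (subst (1 2) sum.swap) simp
  also have "(\<Sum>p\<in>?P. (\<Sum>e\<in>out_arcs G v. real (count_list p e)) -
        (\<Sum>e\<in>in_arcs G v. real (count_list p e))) = (\<Sum>p\<in>?P. of_bool (v = a) - of_bool (v = b))"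
    by (intro sum.cong refl divergence_count_list) (auto simp: apath_def)
  finally show ?thesis
    using card by simp
qed

lemma path_average_nonneg: "0 \<le> path_average a b e"
  by (auto simp: path_average_def intro!: divide_nonneg_nonneg sum_nonneg)

lemma path_average_unit_flow:
  assumes "a \<noteq> b" and "apath a q b"
  shows "path_average a b \<in> unit_flows G a b"
proof -
  have "(\<Sum>e\<in>in_arcs G v. path_average a b e) = (\<Sum>e\<in>out_arcs G v. path_average a b e)"
    if "v \<noteq> a" "v \<noteq> b" for v
    using divergence_path_average[OF assms(2), of v] that by simp
  then show ?thesis
    using divergence_path_average[OF assms(2), of a] \<open>a \<noteq> b\<close>
    by (simp add: unit_flows_def path_average_nonneg)
qed

lemma count_list_apath:
  assumes "apath u p w"
  shows "count_list p e = of_bool (e \<in> set p)"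
proof -
  \<comment> \<open>A repeated arc would repeat its tail among the vertices of the path.\<close>
  have "distinct p"
    using assms by (auto simp: apath_def awalk_verts_conv distinct_map split: if_splits)
  then show ?thesis
    by (induction p) auto
qed

lemma path_average_eq_card:
  "path_average a b e = real (card {p. apath a p b \<and> e \<in> set p}) / real (card {p. apath a p b})"
proof -
  have "(\<Sum>p | apath a p b. real (count_list p e)) =
      (\<Sum>p | apath a p b. if e \<in> set p then 1 else 0)"
    by (intro sum.cong) (auto simp: count_list_apath)
  also have "\<dots> = real (card {p. apath a p b \<and> e \<in> set p})"
    using apaths_finite by (simp add: sum.If_cases Int_def)
  finally show ?thesis
    by (simp add: path_average_def)
qed

lemma path_average_bridge:
  assumes "apath a q b" and "e \<in> ab_bridges G a b"
  shows "path_average a b e = 1"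
proof -
  have "{p. apath a p b \<and> e \<in> set p} = {p. apath a p b}"
    using assms by (auto simp: ab_bridges_def)
  moreover have "card {p. apath a p b} \<noteq> 0"
    using assms apaths_finite by auto
  ultimately show ?thesis
    by (simp add: path_average_eq_card)
qed

text \<open>Some path avoids \<open>e\<close>, so the fraction of paths through \<open>e\<close> is
  strictly below 1. Strictness is what makes its powers vanish in the limit.\<close>

lemma path_average_nonbridge:
  assumes "e \<in> arcs G" and "e \<notin> ab_bridges G a b"
  shows "path_average a b e < 1"
proof -
  obtain q where q: "apath a q b" "e \<notin> set q"
    using assms by (auto simp: ab_bridges_def)
  then have "card {p. apath a p b \<and> e \<in> set p} < card {p. apath a p b}"
    by (intro psubset_card_mono apaths_finite) auto
  then show ?thesis
    by (simp add: path_average_eq_card divide_less_eq)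
qed

end

section \<open>Powers, infima and the resistance for equal parameters\<close>

lemma tendsto_powr_at_right_0:
  fixes x :: real
  assumes "0 \<le> x" and "x < 1"
  shows "((\<lambda>r. x powr (1 + 1 / r)) \<longlongrightarrow> 0) (at_right 0)"
proof (cases "x = 0")
  case False
  then have x: "0 < x" "ln x < 0"
    using assms by auto
  have "filterlim (\<lambda>r::real. 1 + 1 / r) at_top (at_right 0)"
    using filterlim_inverse_at_top_right
    by (intro filterlim_tendsto_add_at_top[OF tendsto_const]) (simp add: divide_inverse)
  then have "filterlim (\<lambda>r. ln x * (1 + 1 / r)) at_bot (at_right 0)"
    using x(2) by (intro filterlim_tendsto_neg_mult_at_bot[OF tendsto_const])
  then have "((\<lambda>r. exp (ln x * (1 + 1 / r))) \<longlongrightarrow> 0) (at_right 0)"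
    by (rule filterlim_compose[OF exp_at_bot])
  then show ?thesis
    using x by (simp add: powr_def mult.commute)
qed simp

text \<open>Multiplication by \<open>c\<close> is an order isomorphism with inverse multiplication
  by \<open>1 / c\<close>. Positivity of \<open>c\<close> matters for empty \<open>A\<close>, where
  both sides must be infinite.\<close>

lemma ennreal_mult_INF:
  fixes f :: "'a \<Rightarrow> ennreal"
  assumes "0 < c"
  shows "ennreal c * (INF x\<in>A. f x) = (INF x\<in>A. ennreal c * f x)"
proof (rule antisym)
  show "ennreal c * (INF x\<in>A. f x) \<le> (INF x\<in>A. ennreal c * f x)"
    by (intro INF_greatest mult_left_mono INF_lower) auto
  have inv: "ennreal (1 / c) * ennreal c = 1" "ennreal c * ennreal (1 / c) = 1"
    using assms by (simp_all flip: ennreal_mult)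
  have "ennreal (1 / c) * (INF x\<in>A. ennreal c * f x) \<le> (INF x\<in>A. f x)"
  proof (rule INF_greatest)
    fix x assume "x \<in> A"
    then have "ennreal (1 / c) * (INF x\<in>A. ennreal c * f x) \<le> ennreal (1 / c) * (ennreal c * f x)"
      by (intro mult_left_mono INF_lower) auto
    also have "\<dots> = f x"
      by (simp add: inv flip: mult.assoc)
    finally show "ennreal (1 / c) * (INF x\<in>A. ennreal c * f x) \<le> f x" .
  qed
  then have "ennreal c * (ennreal (1 / c) * (INF x\<in>A. ennreal c * f x)) \<le>
      ennreal c * (INF x\<in>A. f x)"
    by (rule mult_left_mono) auto
  then show "(INF x\<in>A. ennreal c * f x) \<le> ennreal c * (INF x\<in>A. f x)"
    by (simp add: inv flip: mult.assoc)
qed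

text \<open>For equal parameters the outer exponent and the exponent of \<open>\<mu> e\<close> are
  both 1, and the factor \<open>1 + 1 / r\<close> cancels the denominator in the
  dissipation.\<close>

lemma resistance_same_parameters:
  assumes "0 < r" and "\<And>e. e \<in> arcs G \<Longrightarrow> 0 \<le> \<mu> e"
  shows "resistance G \<mu> r r a b =
    (INF y\<in>unit_flows G a b. ennreal (\<Sum>e\<in>arcs G. \<mu> e * y e powr (1 + 1 / r)))"
proof -
  have rpow: "ennreal_rpow x 1 = x" for x
    by (cases x) (auto simp: ennreal_rpow_def)
  have "ennreal (1 + 1 / r) * (INF y\<in>unit_flows G a b. ennreal (dissipation G \<mu> r r y)) =
      (INF y\<in>unit_flows G a b. ennreal (1 + 1 / r) * ennreal (dissipation G \<mu> r r y))"
    using assms(1) by (intro ennreal_mult_INF) (auto simp: add_pos_pos)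
  also have "\<dots> =
      (INF y\<in>unit_flows G a b. ennreal (\<Sum>e\<in>arcs G. \<mu> e * y e powr (1 + 1 / r)))"
  proof (intro INF_cong refl)
    fix y
    have "0 < 1 + 1 / r"
      using assms(1) by (simp add: add_pos_pos)
    then have "(1 + 1 / r) * dissipation G \<mu> r r y = (\<Sum>e\<in>arcs G. \<mu> e * y e powr (1 + 1 / r))"
      using assms unfolding dissipation_def sum_distrib_left by (intro sum.cong) auto
    with \<open>0 < 1 + 1 / r\<close> show "ennreal (1 + 1 / r) * ennreal (dissipation G \<mu> r r y) =
        ennreal (\<Sum>e\<in>arcs G. \<mu> e * y e powr (1 + 1 / r))"
      by (metis ennreal_mult' less_imp_le)
  qed
  finally show ?thesis
    using assms(1) by (simp add: resistance_def rpow)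
qed

theorem mainTheorem3:
  fixes G :: "('a, 'b) pre_digraph" and \<mu> :: "'b \<Rightarrow> real" and a b :: 'a
  assumes "fin_digraph G" and "loopfree_digraph G"
    and "\<And>e. e \<in> arcs G \<Longrightarrow> 0 \<le> \<mu> e"
    and "a \<in> verts G" and "b \<in> verts G" and "a \<noteq> b"
  shows "((\<lambda>r. resistance G \<mu> r r a b) \<longlongrightarrow> bridge_dist G \<mu> a b) (at_right 0)"
proof -
  interpret fin_digraph G
    by fact
  let ?B = "ab_bridges G a b"
  have pos: "\<forall>\<^sub>F r :: real in at_right 0. 0 < r"
    by (rule eventually_at_right_less)
  show ?thesis
  proof (cases "\<exists>p. apath a p b")
    case False
    \<comment> \<open>There are no unit flows, and the infimum of the empty set is infinite.\<close>
    then have "\<forall>\<^sub>F r in at_right 0. resistance G \<mu> r r a b = bridge_dist G \<mu> a b"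
      using pos assms
      by (auto elim!: eventually_mono
          simp: resistance_same_parameters unit_flows_empty bridge_dist_def)
    then show ?thesis
      by (rule tendsto_eventually)
  next
    case True
    then obtain q where q: "apath a q b" ..
    \<comment> \<open>This competitor does not depend on \<open>r\<close>, so its limit can be taken
      arc by arc.\<close>
    define y where "y = path_average a b"
    have y: "y \<in> unit_flows G a b"
      unfolding y_def using \<open>a \<noteq> b\<close> q by (rule path_average_unit_flow)
    have B: "?B \<subseteq> arcs G"
      by (auto simp: ab_bridges_def)
    have dist: "bridge_dist G \<mu> a b = ennreal (\<Sum>e\<in>?B. \<mu> e)"
      using True by (simp add: bridge_dist_def)
    have lower: "ennreal (\<Sum>e\<in>?B. \<mu> e) \<le> resistance G \<mu> r r a b" if "0 < r" for r
    proof -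
      have "(\<Sum>e\<in>?B. \<mu> e) \<le> (\<Sum>e\<in>arcs G. \<mu> e * z e powr (1 + 1 / r))"
        if z: "z \<in> unit_flows G a b" for z
      proof -
        have "\<mu> e \<le> \<mu> e * z e powr (1 + 1 / r)" if "e \<in> ?B" for e
        proof -
          have "1 \<le> z e powr (1 + 1 / r)"
            using unit_flow_ge_1_on_bridge[OF z \<open>a \<in> verts G\<close> that] \<open>0 < r\<close>
            by (intro ge_one_powr_ge_zero) auto
          moreover have "0 \<le> \<mu> e"
            using assms(3) B that by auto
          ultimately show ?thesis
            using mult_left_mono by fastforce
        qed
        then have "(\<Sum>e\<in>?B. \<mu> e) \<le> (\<Sum>e\<in>?B. \<mu> e * z e powr (1 + 1 / r))"
          by (rule sum_mono)
        also have "\<dots> \<le> (\<Sum>e\<in>arcs G. \<mu> e * z e powr (1 + 1 / r))"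
          using assms(3) B by (intro sum_mono2) auto
        finally show ?thesis .
      qed
      then show ?thesis
        using assms(3) \<open>0 < r\<close>
        by (auto simp: resistance_same_parameters intro!: INF_greatest ennreal_leI)
    qed
    have upper: "resistance G \<mu> r r a b \<le> ennreal (\<Sum>e\<in>arcs G. \<mu> e * y e powr (1 + 1 / r))"
      if "0 < r" for r
      using assms(3) y that by (auto simp: resistance_same_parameters intro: INF_lower)
    have "((\<lambda>r. y e powr (1 + 1 / r)) \<longlongrightarrow> of_bool (e \<in> ?B)) (at_right 0)" if "e \<in> arcs G" for e
    proof (cases "e \<in> ?B")
      case True
      then show ?thesis
        using path_average_bridge[OF q] by (simp add: y_def)
    next
      case False
      then show ?thesis
        using path_average_nonbridge[OF that False] path_average_nonneg
        by (auto simp: y_def intro: tendsto_powr_at_right_0)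
    qed
    then have "((\<lambda>r. \<Sum>e\<in>arcs G. \<mu> e * y e powr (1 + 1 / r)) \<longlongrightarrow>
        (\<Sum>e\<in>arcs G. \<mu> e * of_bool (e \<in> ?B))) (at_right 0)"
      by (intro tendsto_intros)
    also have "(\<Sum>e\<in>arcs G. \<mu> e * of_bool (e \<in> ?B)) = (\<Sum>e\<in>?B. \<mu> e)"
      using B by (intro sum.mono_neutral_cong_right) auto
    finally have lim: "((\<lambda>r. ennreal (\<Sum>e\<in>arcs G. \<mu> e * y e powr (1 + 1 / r))) \<longlongrightarrow>
        ennreal (\<Sum>e\<in>?B. \<mu> e)) (at_right 0)"
      by (rule tendsto_ennrealI)
    have "\<forall>\<^sub>F r in at_right 0. ennreal (\<Sum>e\<in>?B. \<mu> e) \<le> resistance G \<mu> r r a b"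
      using pos by (rule eventually_mono) (rule lower)
    moreover have "\<forall>\<^sub>F r in at_right 0. resistance G \<mu> r r a b \<le>
        ennreal (\<Sum>e\<in>arcs G. \<mu> e * y e powr (1 + 1 / r))"
      using pos by (rule eventually_mono) (rule upper)
    \<comment> \<open>The lower bound is constant in \<open>r\<close>, and the upper bound tends to
      the same value.\<close>
    ultimately show ?thesis
      unfolding dist using tendsto_const lim by (rule tendsto_sandwich)
  qed
qed

end
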